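(* Let $Y\subsetneq\mathbb{C}$ and $\Omega\subsetneq\mathbb{C}$ be proper subdomains of $\mathbb{C}$. Then for every $w\in\Omega$, $$\eta_\Omega^Y(w)\ge\eta_\Omega(w),$$ where $\eta_\Omega$ is the Hurwitz density of $\Omega$ and $\eta_\Omega^Y$ is the generalized Hurwitz density of $\Omega$ with basepoint domain $Y$.
   Context: A domain is a nonempty connected open subset of $\mathbb{C}$; $\mathbb{D}$ is the open unit disk. For a proper subdomain $\Omega\subsetneq\mathbb{C}$ and $w\in\Omega$, let $\mathcal{H}(w,\Omega)$ be the family of holomorphic functions $h:\mathbb{D}\to\Omega$ with $h(0)=w$, $h(t)\neq w$ for all $t\in\mathbb{D}\setminus\{0\}$, and $h'(0)>0$. The Hurwitz density of $\Omega$ is $\eta_\Omega(w)=2/r_\Omega(w)$, where $r_\Omega(w)=\max\{h'(0):h\in\mathcal{H}(w,\Omega)\}$. For a proper subdomain $Y\subsetneq\mathbb{C}$ and any domain $\Omega\subset\mathbb{C}$, the generalized Hurwitz density of $\Omega$ with basepoint domain $Y$ is $\eta_\Omega^Y(w)=\inf \eta_Y(s)/|h'(s)|$, the infimum being over all $s\in Y$ and all holomorphic $h:Y\to\Omega$ with $h(s)=w$, $h(t)\ne w$ for all $t\in Y\setminus\{s\}$, and $h'(s)\neq0$; it may equal $+\infty$ (infimum over the empty set). *)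

theory Defs
  imports "HOL-Complex_Analysis.Complex_Analysis"
begin

definition planar_domain :: "complex set \<Rightarrow> bool" where
  "planar_domain \<Omega> \<longleftrightarrow> \<Omega> \<noteq> {} \<and> open \<Omega> \<and> connected \<Omega>"

definition proper_subdomain :: "complex set \<Rightarrow> bool" where
  "proper_subdomain \<Omega> \<longleftrightarrow> planar_domain \<Omega> \<and> \<Omega> \<noteq> UNIV"

(* A holomorphic function on the unit disk is represented by a total function; its values off the
   disk are irrelevant.  The last two conjuncts say that h'(0) is a positive real number. *)
definition hurwitz_family :: "complex \<Rightarrow> complex set \<Rightarrow> (complex \<Rightarrow> complex) set" where
  "hurwitz_family w \<Omega> =
     {h. h holomorphic_on ball 0 1 \<and> h ` ball 0 1 \<subseteq> \<Omega> \<and> h 0 = w \<and>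
         (\<forall>t\<in>ball 0 1 - {0}. h t \<noteq> w) \<and> deriv h 0 \<in> \<real> \<and> Re (deriv h 0) > 0}"

(* GREATEST is the maximum of a possibly infinite set.  It exists whenever \<Omega> is a proper
   subdomain and w lies in \<Omega>; other arguments are not used. *)
definition hurwitz_radius :: "complex set \<Rightarrow> complex \<Rightarrow> real" where
  "hurwitz_radius \<Omega> w = (GREATEST r. r \<in> (\<lambda>h. Re (deriv h 0)) ` hurwitz_family w \<Omega>)"

definition hurwitz_density :: "complex set \<Rightarrow> complex \<Rightarrow> real" where
  "hurwitz_density \<Omega> w = 2 / hurwitz_radius \<Omega> w"

(* The infimum is taken in the extended reals, so that it is \<infinity> when there is no admissible
   pair (s, h). *)
definition generalized_hurwitz_density :: "complex set \<Rightarrow> complex set \<Rightarrow> complex \<Rightarrow> ereal" where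
  "generalized_hurwitz_density Y \<Omega> w =
     Inf {ereal (hurwitz_density Y s / norm (deriv h s)) | s h.
            s \<in> Y \<and> h holomorphic_on Y \<and> h ` Y \<subseteq> \<Omega> \<and> h s = w \<and>
            (\<forall>t\<in>Y - {s}. h t \<noteq> w) \<and> deriv h s \<noteq> 0}"

end

theory Submission
  imports Defs
begin

text \<open>
  The maximum defining the Hurwitz radius is attained. Fix \<open>a \<notin> \<Omega>\<close>; if \<open>h\<close> belongs to the family at
  \<open>w\<close>, then \<open>(a - h) / (a - w)\<close> has no zeros and takes the value 1 only at 0. Its square root \<open>S\<close>
  with \<open>S 0 = 1\<close> therefore omits both 0 and -1: a point where \<open>S = -1\<close> would have to be 0.
  Schottky's theorem bounds \<open>S\<close> locally uniformly, so the family is normal by Montel's theorem, and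
  by Hurwitz's theorem the limit of a maximising sequence stays in the family.
  Given an admissible pair \<open>(s, h)\<close>, composing \<open>h\<close> with an extremal map for \<open>Y\<close> at \<open>s\<close> and rotating
  yields \<open>r\<^sub>\<Omega>(w) \<ge> \<bar>h'(s)\<bar> r\<^sub>Y(s)\<close>.
\<close>

lemma hurwitz_familyD:
  assumes "h \<in> hurwitz_family w \<Omega>"
  shows "h holomorphic_on ball 0 1" and "\<And>z. norm z < 1 \<Longrightarrow> h z \<in> \<Omega>" and "h 0 = w"
    and "\<And>z. norm z < 1 \<Longrightarrow> z \<noteq> 0 \<Longrightarrow> h z \<noteq> w"
    and "deriv h 0 = of_real (Re (deriv h 0))" and "Re (deriv h 0) > 0"
  using assms by (auto simp: hurwitz_family_def image_subset_iff complex_is_Real_iff complex_eq_iff)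

text \<open>Schottky's constant depends only on the radius and on a bound for the value at the
  centre, and the normalisation makes that value the same for every member. Hence one
  \<open>B\<close> serves the whole family, as Montel's theorem requires.\<close>

lemma hurwitz_family_locally_bounded:
  assumes "a \<notin> \<Omega>" and "w \<in> \<Omega>" and "0 < \<rho>" "\<rho> < 1"
  obtains B where "\<And>h z. h \<in> hurwitz_family w \<Omega> \<Longrightarrow> norm z \<le> \<rho> \<Longrightarrow> norm (h z) \<le> B"
proof -
  \<comment> \<open>Schottky's theorem is applied to a function holomorphic on the closed unit disk,
    while \<open>S\<close> lives only on the open one. Rescaling by some \<sigma> strictly between
    \<rho> and 1 repairs this and sends the disk of radius \<rho> to one of radius \<rho>/\<sigma> <
    1.\<close>
  define \<sigma> where "\<sigma> = (1 + \<rho>) / 2"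
  have \<sigma>: "0 < \<sigma>" "\<sigma> < 1" "\<rho> < \<sigma>" using assms by (auto simp: \<sigma>_def)
  \<comment> \<open>This is Schottky's bound for initial modulus at most 1 and radius
    \<rho>/\<sigma>.\<close>
  define C where "C = exp (pi * exp (pi * (2 + 2 * 1 + 12 * (\<rho> / \<sigma>) / (1 - \<rho> / \<sigma>))))"
  have aw: "a \<noteq> w" using assms by auto
  have "norm (h z) \<le> norm a + norm (a - w) * C\<^sup>2"
    if h: "h \<in> hurwitz_family w \<Omega>" and z: "norm z \<le> \<rho>" for h z
  proof -
    note H = hurwitz_familyD[OF h]
    define F where "F = (\<lambda>z. (a - h z) / (a - w))"
    have "F holomorphic_on ball 0 1"
      unfolding F_def using aw by (auto intro!: holomorphic_intros H(1))
    moreover have "F x \<noteq> 0" if "x \<in> ball 0 1" for x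
      using H(2)[of x] that \<open>a \<notin> \<Omega>\<close> aw by (auto simp: F_def)
    ultimately obtain S where holS: "S holomorphic_on ball 0 1"
      and S: "\<And>x. x \<in> ball 0 1 \<Longrightarrow> F x = (S x)\<^sup>2"
      using contractible_imp_holomorphic_sqrt[of F "ball 0 1"] convex_imp_contractible convex_ball
      by metis
    have S0: "(S 0)\<^sup>2 = 1" using S[of 0] aw by (simp add: F_def H(3))
    then have S0': "S 0 \<noteq> 0" by auto
    have im: "of_real \<sigma> * x \<in> ball 0 1" if "x \<in> cball 0 1" for x :: complex
      using that \<sigma> by (simp add: norm_mult) (meson mult_left_le order_le_less_trans order_less_imp_le)
    \<comment> \<open>Since \<open>S 0\<close> is 1 or -1, dividing by it picks the branch with
      value 1 at the origin. The minus sign turns the omitted value -1 into 1, so that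
      \<open>f\<close> omits 0 and 1, and \<open>f 0 = -1\<close>.\<close>
    define f where "f = (\<lambda>x. - S (of_real \<sigma> * x) / S 0)"
    have sq: "(f x)\<^sup>2 = F (of_real \<sigma> * x)" if "norm x \<le> 1" for x
      using S[OF im] that S0 by (simp add: f_def power_divide)
    have "norm (f (z / of_real \<sigma>)) \<le> C"
      unfolding C_def
    proof (rule Schottky[of f])
      have "(S \<circ> (\<lambda>x. of_real \<sigma> * x)) holomorphic_on cball 0 1"
        by (rule holomorphic_on_compose_gen[OF _ holS]) (use im in \<open>auto intro!: holomorphic_intros\<close>)
      then show "f holomorphic_on cball 0 1"
        using S0' by (auto simp: f_def o_def intro!: holomorphic_intros)
      show "norm (f 0) \<le> 1" using S0' by (simp add: f_def)
      show "\<not> (f x = 0 \<or> f x = 1)" if x: "x \<in> cball 0 1" for x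
      proof
        let ?y = "of_real \<sigma> * x"
        have y: "norm ?y < 1" using im[OF x] by simp
        assume "f x = 0 \<or> f x = 1"
        then show False
        proof
          assume "f x = 0"
          then have "F ?y = 0" using sq[of x] x by simp
          then show False using H(2)[OF y] \<open>a \<notin> \<Omega>\<close> aw by (auto simp: F_def)
        next
          \<comment> \<open>Squaring loses the sign, so this point is a preimage of \<open>w\<close>
            under \<open>h\<close>, which must be the origin; but there the branch has the opposite
            sign.\<close>
          assume 1: "f x = 1"
          then have "F ?y = 1" using sq[of x] x by simp
          then have "h ?y = w" using aw by (simp add: F_def)
          then have "?y = 0" using H(4)[OF y] by auto
          then have "f x = -1" using S0' \<sigma> by (simp add: f_def)
          then show False using 1 by simp
        qed
      qed
      show "0 < \<rho> / \<sigma>" "\<rho> / \<sigma> < 1" using assms \<sigma> by auto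
      show "norm (z / of_real \<sigma>) \<le> \<rho> / \<sigma>" using z \<sigma> by (simp add: norm_divide divide_right_mono)
    qed
    then have "norm ((f (z / of_real \<sigma>))\<^sup>2) \<le> C\<^sup>2"
      by (simp add: norm_power power_mono)
    moreover have "norm (z / of_real \<sigma>) \<le> 1"
      using z \<sigma> by (simp add: norm_divide)
    ultimately have "norm (F z) \<le> C\<^sup>2"
      using sq[of "z / of_real \<sigma>"] \<sigma> by simp
    moreover have "h z = a - (a - w) * F z" using aw by (simp add: F_def)
    ultimately show ?thesis
      using norm_triangle_ineq4[of a "(a - w) * F z"] mult_left_mono[of "norm (F z)" "C\<^sup>2" "norm (a - w)"]
      by (simp add: norm_mult)
  qed
  then show ?thesis using that by blast
qed

text \<open>Positivity of \<open>m\<close> keeps the limit from being constant, which is the only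
  way Hurwitz's theorem could fail to pass omitted values on to \<open>g\<close>.\<close>

lemma hurwitz_family_limit:
  assumes fam: "\<And>n::nat. f n \<in> hurwitz_family w \<Omega>" and "w \<in> \<Omega>"
    and holg: "g holomorphic_on ball 0 1"
    and ul: "\<And>K. compact K \<Longrightarrow> K \<subseteq> ball 0 1 \<Longrightarrow> uniform_limit K f g sequentially"
    and lim: "(\<lambda>n. Re (deriv (f n) 0)) \<longlonglongrightarrow> m" and "m > 0"
  shows "g \<in> hurwitz_family w \<Omega>" and "Re (deriv g 0) = m"
proof -
  note H = hurwitz_familyD[OF fam]
  have "uniform_limit (ball 0 (1/2)) f g sequentially"
    by (rule uniform_limit_on_subset[OF ul[of "cball 0 (1/2)"]]) auto
  then have "(\<lambda>n. deriv (f n) 0) \<longlonglongrightarrow> deriv g 0"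
    by (rule deriv_complex_uniform_limit)
       (auto intro!: always_eventually holomorphic_on_subset[OF H(1)])
  \<comment> \<open>The derivatives at 0 are real, so convergence of their real parts is convergence
    in the complex plane.\<close>
  moreover have "(\<lambda>n. deriv (f n) 0) \<longlonglongrightarrow> of_real m"
    by (subst H(5)) (intro tendsto_of_real lim)
  ultimately have dg: "deriv g 0 = of_real m" by (rule LIMSEQ_unique)
  then show "Re (deriv g 0) = m" by simp
  have "(\<lambda>n. f n 0) \<longlonglongrightarrow> g 0"
    by (rule tendsto_uniform_limitI[OF ul[of "{0}"]]) auto
  then have g0: "g 0 = w" using H(3) by (simp add: LIMSEQ_const_iff)
  \<comment> \<open>Hurwitz's theorem is used on the punctured disk, because each \<open>f n\<close>
    does take the value \<open>w\<close> at 0. A constant there would extend to 0 by continuity and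
    make \<open>deriv g 0\<close> vanish.\<close>
  have nonconst: "\<not> (\<lambda>z. g z - b) constant_on ball 0 1 - {0}" for b
  proof
    assume "(\<lambda>z. g z - b) constant_on ball 0 1 - {0}"
    then obtain c where c: "\<And>z. z \<in> ball 0 1 - {0} \<Longrightarrow> g z = c"
      by (force simp: constant_on_def algebra_simps)
    have "g \<midarrow>0\<rightarrow> g 0"
      using holomorphic_on_imp_continuous_on[OF holg]
      by (metis centre_in_ball continuous_on_eq_continuous_at continuous_at open_ball isCont_def zero_less_one)
    moreover have "g \<midarrow>0\<rightarrow> c"
      by (rule Lim_transform_within_open[OF tendsto_const, of "ball 0 1"]) (use c in auto)
    ultimately have "g 0 = c" by (rule LIM_unique)
    with c have c': "\<And>z. z \<in> ball 0 1 \<Longrightarrow> g z = c" by (metis DiffI singletonD)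
    have "(g has_field_derivative 0) (at 0)"
      by (rule has_field_derivative_transform_within_open[of "\<lambda>_. c" _ _ "ball 0 1"]) (use c' in auto)
    then have "deriv g 0 = 0" by (rule DERIV_imp_deriv)
    with dg \<open>m > 0\<close> show False by simp
  qed
  have omit: "g z \<noteq> b" if "z \<in> ball 0 1 - {0}" and b: "\<And>n x. x \<in> ball 0 1 - {0} \<Longrightarrow> f n x \<noteq> b" for b z
  proof -
    have "(\<lambda>z. g z - b) z \<noteq> 0"
    proof (rule Hurwitz_no_zeros[of "ball 0 1 - {0}" "\<lambda>n z. f n z - b" "\<lambda>z. g z - b"])
      show "connected (ball 0 1 - {0::complex})" by (rule connected_punctured_ball) simp
      show "uniform_limit K (\<lambda>n z. f n z - b) (\<lambda>z. g z - b) sequentially"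
        if "compact K" "K \<subseteq> ball 0 1 - {0}" for K
        by (intro uniform_limit_intros ul) (use that in auto)
      show "\<not> (\<lambda>z. g z - b) constant_on ball 0 1 - {0}" by (rule nonconst)
      show "(\<lambda>z. f n z - b) holomorphic_on ball 0 1 - {0}" for n
        by (intro holomorphic_intros holomorphic_on_subset[OF H(1)]) auto
      show "(\<lambda>z. g z - b) holomorphic_on ball 0 1 - {0}"
        by (intro holomorphic_intros holomorphic_on_subset[OF holg]) auto
    qed (use that in auto)
    then show ?thesis by simp
  qed
  have "g z \<in> \<Omega>" if "z \<in> ball 0 1" for z
  proof (cases "z = 0")
    case False
    \<comment> \<open>If \<open>g z\<close> lay outside \<Omega>, it would be a value omitted by
      every \<open>f n\<close>, hence by \<open>g\<close> itself. So the limit lands in \<Omega> and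
      not merely in its closure.\<close>
    show ?thesis
    proof (rule ccontr)
      assume "g z \<notin> \<Omega>"
      then have "f n x \<noteq> g z" if "x \<in> ball 0 1 - {0}" for n x
        using H(2)[of x n] that by auto
      then show False using omit[of z "g z"] False that by blast
    qed
  qed (use g0 \<open>w \<in> \<Omega>\<close> in simp)
  moreover have "g z \<noteq> w" if "z \<in> ball 0 1 - {0}" for z
    by (rule omit[OF that]) (use H(4) in auto)
  ultimately show "g \<in> hurwitz_family w \<Omega>"
    using holg g0 dg \<open>m > 0\<close> by (auto simp: hurwitz_family_def)
qed

lemma hurwitz_family_nonempty:
  assumes "open \<Omega>" "w \<in> \<Omega>"
  shows "hurwitz_family w \<Omega> \<noteq> {}"
proof -
  obtain e where e: "e > 0" "ball w e \<subseteq> \<Omega>" using assms open_contains_ball by blast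
  have "deriv (\<lambda>z. w + of_real e * z) 0 = of_real e"
    by (rule DERIV_imp_deriv) (auto intro!: derivative_eq_intros)
  moreover have "w + of_real e * z \<in> \<Omega>" if "norm z < 1" for z
    using e that by (intro subsetD[OF e(2)]) (simp add: dist_norm norm_mult)
  ultimately have "(\<lambda>z. w + of_real e * z) \<in> hurwitz_family w \<Omega>"
    using e by (auto simp: hurwitz_family_def intro!: holomorphic_intros)
  then show ?thesis by blast
qed

text \<open>\<open>GREATEST\<close> carries information only once a maximum is known to exist, so
  the supremum is taken first and then shown to be attained.\<close>

lemma hurwitz_radius_attained:
  assumes "proper_subdomain \<Omega>" "w \<in> \<Omega>"
  shows "\<exists>g\<in>hurwitz_family w \<Omega>. Re (deriv g 0) = hurwitz_radius \<Omega> w"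
    and "\<And>h. h \<in> hurwitz_family w \<Omega> \<Longrightarrow> Re (deriv h 0) \<le> hurwitz_radius \<Omega> w"
proof -
  have op: "open \<Omega>" and "\<Omega> \<noteq> UNIV"
    using assms by (auto simp: proper_subdomain_def planar_domain_def)
  then obtain a where a: "a \<notin> \<Omega>" by blast
  define X where "X = (\<lambda>h. Re (deriv h 0)) ` hurwitz_family w \<Omega>"
  have ne: "X \<noteq> {}" using hurwitz_family_nonempty[OF op \<open>w \<in> \<Omega>\<close>] by (simp add: X_def)
  have "\<exists>B. \<forall>x\<in>X. x \<le> B"
  proof -
    obtain B where B: "\<And>h z. h \<in> hurwitz_family w \<Omega> \<Longrightarrow> norm z \<le> 1/2 \<Longrightarrow> norm (h z) \<le> B"
      using hurwitz_family_locally_bounded[OF a \<open>w \<in> \<Omega>\<close>, of "1/2"] by auto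
    \<comment> \<open>Cauchy's estimate on the disk of radius 1/2 bounds all derivatives at 0 by
      \<open>2 * B\<close>.\<close>
    have "Re (deriv h 0) \<le> fact 1 * B / (1/2)^1" if h: "h \<in> hurwitz_family w \<Omega>" for h
    proof -
      have hol: "h holomorphic_on cball 0 (1/2)"
        by (rule holomorphic_on_subset[OF hurwitz_familyD(1)[OF h]]) auto
      have "norm ((deriv ^^ 1) h 0) \<le> fact 1 * B / (1/2)^1"
      proof (rule Cauchy_inequality)
        show "h holomorphic_on ball 0 (1/2)" using hol by (rule holomorphic_on_subset) auto
        show "continuous_on (cball 0 (1/2)) h" using hol by (rule holomorphic_on_imp_continuous_on)
      qed (use B[OF h] in auto)
      then show ?thesis using complex_Re_le_cmod[of "deriv h 0"] by simp
    qed
    then show ?thesis by (auto simp: X_def)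
  qed
  then have bdd: "bdd_above X" by (auto simp: bdd_above_def)
  have pos: "x > 0" if "x \<in> X" for x
    using that hurwitz_familyD(6) by (auto simp: X_def)
  define m where "m = Sup X"
  have upper: "x \<le> m" if "x \<in> X" for x unfolding m_def using that bdd by (rule cSup_upper)
  have "m > 0" using ne pos upper by force
  have "\<exists>h\<in>hurwitz_family w \<Omega>. m - inverse (real (Suc n)) < Re (deriv h 0)" for n
    using less_cSup_iff[OF ne bdd, of "m - inverse (real (Suc n))"] by (auto simp: m_def X_def)
  then obtain f where fam: "\<And>n::nat. f n \<in> hurwitz_family w \<Omega>"
    and f: "\<And>n. m - inverse (real (Suc n)) < Re (deriv (f n) 0)" by metis
  have lim: "(\<lambda>n. Re (deriv (f n) 0)) \<longlonglongrightarrow> m"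
  proof (rule tendsto_sandwich)
    show "(\<lambda>n. m - inverse (real (Suc n))) \<longlonglongrightarrow> m"
      using tendsto_diff[OF tendsto_const[of m] LIMSEQ_inverse_real_of_nat] by simp
    show "\<forall>\<^sub>F n in sequentially. Re (deriv (f n) 0) \<le> m"
      using fam upper by (auto simp: X_def)
  qed (use f less_imp_le in \<open>auto intro!: always_eventually simp del: of_nat_Suc\<close>)
  obtain g r where g: "g holomorphic_on ball 0 1" and r: "strict_mono (r :: nat \<Rightarrow> nat)"
    and ul: "\<And>K. \<lbrakk>compact K; K \<subseteq> ball 0 1\<rbrakk> \<Longrightarrow> uniform_limit K (f \<circ> r) g sequentially"
  proof (rule Montel[of "ball 0 1" "hurwitz_family w \<Omega>" f])
    fix K :: "complex set" assume K: "compact K" "K \<subseteq> ball 0 1"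
    have "\<exists>\<rho>. 0 < \<rho> \<and> \<rho> < 1 \<and> K \<subseteq> cball 0 \<rho>"
    proof (cases "K = {}")
      case True
      then show ?thesis by (intro exI[of _ "1/2"]) auto
    next
      case False
      obtain x where x: "x \<in> K" "\<And>y. y \<in> K \<Longrightarrow> norm y \<le> norm x"
        using continuous_attains_sup[OF K(1) False continuous_on_norm_id] by blast
      then show ?thesis
        \<comment> \<open>The maximum with 1/2 keeps the radius positive when \<open>K\<close> is
          just the origin.\<close>
        using K(2) by (intro exI[of _ "max (1/2) (norm x)"]) force
    qed
    then obtain \<rho> where \<rho>: "0 < \<rho>" "\<rho> < 1" "K \<subseteq> cball 0 \<rho>" by blast
    obtain B where "\<And>h z. h \<in> hurwitz_family w \<Omega> \<Longrightarrow> norm z \<le> \<rho> \<Longrightarrow> norm (h z) \<le> B"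
      using hurwitz_family_locally_bounded[OF a \<open>w \<in> \<Omega>\<close> \<rho>(1,2)] by blast
    then show "\<exists>B. \<forall>h\<in>hurwitz_family w \<Omega>. \<forall>z\<in>K. norm (h z) \<le> B"
      using \<rho>(3) by (intro exI[of _ B]) auto
  qed (use fam hurwitz_familyD(1) in auto)
  have "(\<lambda>n. Re (deriv ((f \<circ> r) n) 0)) \<longlonglongrightarrow> m"
    using LIMSEQ_subseq_LIMSEQ[OF lim r] by (simp add: o_def)
  then have g': "g \<in> hurwitz_family w \<Omega>" "Re (deriv g 0) = m"
    using hurwitz_family_limit[of "f \<circ> r", OF _ \<open>w \<in> \<Omega>\<close> g ul _ \<open>m > 0\<close>] fam by auto
  then have "m \<in> X" by (auto simp: X_def)
  then have "hurwitz_radius \<Omega> w = m"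
    unfolding hurwitz_radius_def X_def[symmetric] using upper by (rule Greatest_equality)
  then show "\<exists>g\<in>hurwitz_family w \<Omega>. Re (deriv g 0) = hurwitz_radius \<Omega> w"
    and "\<And>h. h \<in> hurwitz_family w \<Omega> \<Longrightarrow> Re (deriv h 0) \<le> hurwitz_radius \<Omega> w"
    using g' upper by (auto simp: X_def)
qed

lemma hurwitz_radius_pos:
  assumes "proper_subdomain \<Omega>" "w \<in> \<Omega>"
  shows "hurwitz_radius \<Omega> w > 0"
  using hurwitz_radius_attained(1)[OF assms] hurwitz_familyD(6) by metis

text \<open>The fibre conditions compose: \<open>h\<close> takes the value \<open>w\<close> only at
  \<open>s\<close>, and the extremal map takes the value \<open>s\<close> only at 0. The composite
  is thus a competitor for \<Omega> at \<open>w\<close>, up to the argument of its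
  derivative.\<close>

lemma hurwitz_radius_mult_le:
  assumes Y: "proper_subdomain Y" and \<Omega>: "proper_subdomain \<Omega>" and "w \<in> \<Omega>" and s: "s \<in> Y"
    and holh: "h holomorphic_on Y" and im: "h ` Y \<subseteq> \<Omega>" and "h s = w"
    and ne: "\<And>t. t \<in> Y - {s} \<Longrightarrow> h t \<noteq> w" and d: "deriv h s \<noteq> 0"
  shows "norm (deriv h s) * hurwitz_radius Y s \<le> hurwitz_radius \<Omega> w"
proof -
  obtain g where g: "g \<in> hurwitz_family s Y" and dg: "Re (deriv g 0) = hurwitz_radius Y s"
    using hurwitz_radius_attained(1)[OF Y s] by blast
  note G = hurwitz_familyD[OF g]
  have opY: "open Y" using Y by (auto simp: proper_subdomain_def planar_domain_def)
  \<comment> \<open>Rotating the disk by the conjugate phase of \<open>deriv h s\<close> makes the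
    derivative of the composite positive without changing its modulus.\<close>
  define u where "u = cnj (sgn (deriv h s))"
  have u: "norm u = 1" using d by (simp add: u_def norm_sgn)
  have du: "deriv h s * u = of_real (norm (deriv h s))"
    using d by (simp add: u_def sgn_eq complex_norm_square[symmetric] power2_eq_square)
  define f where "f = (\<lambda>z. h (g (u * z)))"
  have D: "deriv f 0 = of_real (norm (deriv h s) * hurwitz_radius Y s)"
  proof -
    have "(h has_field_derivative deriv h s) (at (g (u * 0)))"
      using holomorphic_derivI[OF holh opY s] G(3) by simp
    moreover have "((\<lambda>z. g (u * z)) has_field_derivative deriv g 0 * u) (at 0)"
    proof (rule DERIV_chain2[of g])
      show "(g has_field_derivative deriv g 0) (at (u * 0))"
        using holomorphic_derivI[OF G(1) open_ball, of 0] by simp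
    qed (auto intro!: derivative_eq_intros)
    ultimately have "(f has_field_derivative deriv h s * (deriv g 0 * u)) (at 0)"
      unfolding f_def by (rule DERIV_chain2)
    then have "deriv f 0 = deriv h s * (deriv g 0 * u)" by (rule DERIV_imp_deriv)
    also have "\<dots> = (deriv h s * u) * deriv g 0" by simp
    also have "\<dots> = of_real (norm (deriv h s) * hurwitz_radius Y s)"
      by (subst G(5), subst du) (simp add: dg)
    finally show ?thesis .
  qed
  have "f \<in> hurwitz_family w \<Omega>"
  proof -
    have "(g \<circ> (\<lambda>z. u * z)) holomorphic_on ball 0 1"
      by (rule holomorphic_on_compose_gen[OF _ G(1)])
         (auto intro!: holomorphic_intros simp: norm_mult u)
    then have "(h \<circ> (g \<circ> (\<lambda>z. u * z))) holomorphic_on ball 0 1"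
      by (rule holomorphic_on_compose_gen[OF _ holh]) (auto simp: norm_mult u G(2))
    then have "f holomorphic_on ball 0 1" by (simp add: f_def o_def)
    moreover have "f ` ball 0 1 \<subseteq> \<Omega>"
      using im by (auto simp: f_def norm_mult u G(2) image_subset_iff)
    moreover have "f 0 = w" using \<open>h s = w\<close> G(3) by (simp add: f_def)
    moreover have "f t \<noteq> w" if "t \<in> ball 0 1 - {0}" for t
    proof -
      have "norm (u * t) < 1" "u * t \<noteq> 0" using that u by (auto simp: norm_mult)
      then show ?thesis using ne G(2,4) by (simp add: f_def)
    qed
    moreover have "norm (deriv h s) * hurwitz_radius Y s > 0"
      using d hurwitz_radius_pos[OF Y s] by simp
    ultimately show ?thesis unfolding hurwitz_family_def using D by simp
  qed
  from hurwitz_radius_attained(2)[OF \<Omega> \<open>w \<in> \<Omega>\<close> this] D show ?thesis by simp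
qed

theorem proposition3p5:
  fixes Y \<Omega> :: "complex set" and w :: complex
  assumes "proper_subdomain Y" and "proper_subdomain \<Omega>" and "w \<in> \<Omega>"
  shows "generalized_hurwitz_density Y \<Omega> w \<ge> ereal (hurwitz_density \<Omega> w)"
proof -
  have "hurwitz_density \<Omega> w \<le> hurwitz_density Y s / norm (deriv h s)"
    if "s \<in> Y" "h holomorphic_on Y" "h ` Y \<subseteq> \<Omega>" "h s = w"
      "\<forall>t\<in>Y - {s}. h t \<noteq> w" "deriv h s \<noteq> 0" for s h
  proof -
    have "norm (deriv h s) * hurwitz_radius Y s \<le> hurwitz_radius \<Omega> w"
      by (rule hurwitz_radius_mult_le) (use assms that in auto)
    moreover have "0 < norm (deriv h s) * hurwitz_radius Y s"
      using that hurwitz_radius_pos assms by simp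
    ultimately have "2 / hurwitz_radius \<Omega> w \<le> 2 / (norm (deriv h s) * hurwitz_radius Y s)"
      by (intro divide_left_mono) auto
    then show ?thesis by (simp add: hurwitz_density_def mult.commute)
  qed
  \<comment> \<open>A lower bound for every member bounds the infimum; with no admissible pair the
    infimum is \<infinity> and the bound is vacuous.\<close>
  then show ?thesis
    unfolding generalized_hurwitz_density_def by (intro Inf_greatest) auto
qed

end
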